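(* The integrality gap $\mathbf{Gap}$ of the linear program (LP) relaxation of the base-model assortment optimization problem is at most $0.75$.
   Context: Base model. Let $n,m$ be positive integers, $\mathbf N=\{1,\dots,n\}$, $\mathbf M=\{1,\dots,m\}$, $\mathbf N_+=\mathbf N\cup\{0\}$, $\mathbf M_+=\mathbf M\cup\{0\}$. Prices $p_i\ge 0$, $q_j\ge 0$, $p_0=q_0=0$. Preference weights $u_{ij}\ge 0$ for $(i,j)\in\mathbf N_+\times\mathbf M_+$, $u_{00}=1$. For $(x,y)\in\{0,1\}^n\times\{0,1\}^m$, with $x_0=y_0=1$, $\pi(x,y)=\frac{\sum_{i,j}u_{ij}x_iy_j(p_i+q_j)}{\sum_{i,j}u_{ij}x_iy_j}$ (sums over $\mathbf N_+\times\mathbf M_+$); $\pi^*_{\mathcal I}$ is the maximum of $\pi$ over all assortments for instance $\mathcal I$. The LP, in nonnegative variables $x\in\mathbb R^n$, $y\in\mathbb R^m$, $z\in\mathbb R^{n\times m}$, $w\in\mathbb R$: maximize $\sum_{i\in\mathbf N,j\in\mathbf M}u_{ij}(p_i+q_j)z_{ij}+\sum_{i}u_{i0}p_ix_i+\sum_{j}u_{0j}q_jy_j$ subject to $w+\sum_{i,j}u_{ij}z_{ij}+\sum_iu_{i0}x_i+\sum_ju_{0j}y_j=1$ and $z_{ij}\le x_i$, $z_{ij}\le y_j$, $z_{ij}\ge x_i+y_j-w$ for all $i\in\mathbf N,j\in\mathbf M$. Let $r^*_{\mathcal I}$ be its optimal value for instance $\mathcal I$. The integrality gap is $\mathbf{Gap}=\inf_{\mathcal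 I}\pi^*_{\mathcal I}/r^*_{\mathcal I}$ over all instances $\mathcal I$. *)

theory Defs
  imports Complex_Main "HOL-Library.FuncSet"
begin

text \<open>An instance is a tuple \<open>n m p q u\<close>: the products are \<open>{1..n}\<close> and \<open>{1..m}\<close>, and index \<open>0\<close>
  stands for the no-purchase option. Values of \<open>p\<close>, \<open>q\<close>, \<open>u\<close> outside the index ranges are irrelevant.\<close>

definition is_instance ::
  "nat \<Rightarrow> nat \<Rightarrow> (nat \<Rightarrow> real) \<Rightarrow> (nat \<Rightarrow> real) \<Rightarrow> (nat \<Rightarrow> nat \<Rightarrow> real) \<Rightarrow> bool" where
  "is_instance n m p q u \<longleftrightarrow>
     n \<ge> 1 \<and> m \<ge> 1 \<and>
     (\<forall>i\<in>{1..n}. p i \<ge> 0) \<and> (\<forall>j\<in>{1..m}. q j \<ge> 0) \<and> p 0 = 0 \<and> q 0 = 0 \<and>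
     (\<forall>i\<in>{0..n}. \<forall>j\<in>{0..m}. u i j \<ge> 0) \<and> u 0 0 = 1"

text \<open>Vectors in \<open>{0,1}\<^sup>k\<close>, extended by the entry \<open>1\<close> at index \<open>0\<close>.\<close>

definition assortments :: "nat \<Rightarrow> (nat \<Rightarrow> real) set" where
  "assortments k = {x \<in> {0..k} \<rightarrow>\<^sub>E {0, 1}. x 0 = 1}"

definition revenue ::
  "nat \<Rightarrow> nat \<Rightarrow> (nat \<Rightarrow> real) \<Rightarrow> (nat \<Rightarrow> real) \<Rightarrow> (nat \<Rightarrow> nat \<Rightarrow> real) \<Rightarrow>
   (nat \<Rightarrow> real) \<Rightarrow> (nat \<Rightarrow> real) \<Rightarrow> real" where
  "revenue n m p q u x y =
     (\<Sum>i\<in>{0..n}. \<Sum>j\<in>{0..m}. u i j * x i * y j * (p i + q j)) /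
     (\<Sum>i\<in>{0..n}. \<Sum>j\<in>{0..m}. u i j * x i * y j)"

definition opt_revenue ::
  "nat \<Rightarrow> nat \<Rightarrow> (nat \<Rightarrow> real) \<Rightarrow> (nat \<Rightarrow> real) \<Rightarrow> (nat \<Rightarrow> nat \<Rightarrow> real) \<Rightarrow> real" where
  "opt_revenue n m p q u =
     Max {revenue n m p q u x y | x y. x \<in> assortments n \<and> y \<in> assortments m}"

definition lp_feasible ::
  "nat \<Rightarrow> nat \<Rightarrow> (nat \<Rightarrow> nat \<Rightarrow> real) \<Rightarrow>
   (nat \<Rightarrow> real) \<Rightarrow> (nat \<Rightarrow> real) \<Rightarrow> (nat \<Rightarrow> nat \<Rightarrow> real) \<Rightarrow> real \<Rightarrow> bool" where
  "lp_feasible n m u x y z w \<longleftrightarrow>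
     (\<forall>i\<in>{1..n}. x i \<ge> 0) \<and> (\<forall>j\<in>{1..m}. y j \<ge> 0) \<and>
     (\<forall>i\<in>{1..n}. \<forall>j\<in>{1..m}. z i j \<ge> 0) \<and> w \<ge> 0 \<and>
     w + (\<Sum>i\<in>{1..n}. \<Sum>j\<in>{1..m}. u i j * z i j)
       + (\<Sum>i\<in>{1..n}. u i 0 * x i) + (\<Sum>j\<in>{1..m}. u 0 j * y j) = 1 \<and>
     (\<forall>i\<in>{1..n}. \<forall>j\<in>{1..m}. z i j \<le> x i \<and> z i j \<le> y j \<and> z i j \<ge> x i + y j - w)"

definition lp_objective ::
  "nat \<Rightarrow> nat \<Rightarrow> (nat \<Rightarrow> real) \<Rightarrow> (nat \<Rightarrow> real) \<Rightarrow> (nat \<Rightarrow> nat \<Rightarrow> real) \<Rightarrow>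
   (nat \<Rightarrow> real) \<Rightarrow> (nat \<Rightarrow> real) \<Rightarrow> (nat \<Rightarrow> nat \<Rightarrow> real) \<Rightarrow> real" where
  "lp_objective n m p q u x y z =
     (\<Sum>i\<in>{1..n}. \<Sum>j\<in>{1..m}. u i j * (p i + q j) * z i j)
       + (\<Sum>i\<in>{1..n}. u i 0 * p i * x i) + (\<Sum>j\<in>{1..m}. u 0 j * q j * y j)"

text \<open>For an instance the feasible region is nonempty (take \<open>w = 1\<close> and the rest \<open>0\<close>) and the
  constraints force \<open>0 \<le> z i j \<le> x i \<le> w \<le> 1\<close> and \<open>0 \<le> y j \<le> w\<close>, so the supremum below
  is over a nonempty bounded set and is attained.\<close>

definition lp_value ::
  "nat \<Rightarrow> nat \<Rightarrow> (nat \<Rightarrow> real) \<Rightarrow> (nat \<Rightarrow> real) \<Rightarrow> (nat \<Rightarrow> nat \<Rightarrow> real) \<Rightarrow> real" where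
  "lp_value n m p q u = Sup {lp_objective n m p q u x y z | x y z w. lp_feasible n m u x y z w}"

text \<open>The optimal LP value is nonnegative. If it is \<open>0\<close>, so is the optimal revenue, and the ratio is
  undefined; such instances are excluded, since otherwise the HOL convention \<open>0 / 0 = 0\<close> would
  make the infimum \<open>0\<close>.\<close>

definition Gap :: real where
  "Gap = Inf {opt_revenue n m p q u / lp_value n m p q u | n m p q u.
                is_instance n m p q u \<and> lp_value n m p q u > 0}"

end

theory Submission
  imports Defs
begin

text \<open>Take three products on each side, with prices \<open>N\<close>, \<open>1\<close>, \<open>0\<close>, and the weights
  \<open>gap_weight N\<close> below. As \<open>N\<close> grows, the products of price \<open>N\<close> are always offered and add a
  bonus of \<open>1\<close> to the numerator for each product \<open>3\<close> offered, at no cost in the denominator, while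
  the heavy pairs \<open>(2,3)\<close>, \<open>(3,2)\<close> force the revenue to about \<open>1\<close> once they are offered.
  Every assortment then has revenue at most \<open>1 + 1/N\<close>. The LP evades the heavy pairs: giving the
  products \<open>2\<close> and \<open>3\<close> the value \<open>w/2\<close> allows \<open>z\<^sub>2\<^sub>3 = z\<^sub>3\<^sub>2 = z\<^sub>3\<^sub>3 = 0\<close> and \<open>z\<^sub>2\<^sub>2 = w/2\<close>, which
  yields \<open>4N / (3N + 2)\<close>. Hence the ratio is at most \<open>(1 + 1/N) (3N + 2) / (4N)\<close>, which tends
  to \<open>3/4\<close>.\<close>

lemma finite_assortments: "finite (assortments k)"
  by (rule finite_subset[of _ "{0..k} \<rightarrow>\<^sub>E {0, 1}"]) (auto simp: assortments_def intro: finite_PiE)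

lemma empty_assortment: "restrict (\<lambda>i. if i = 0 then 1 else 0) {0..k} \<in> assortments k"
  by (auto simp: assortments_def)

lemma finite_revenues:
  "finite {revenue n m p q u x y | x y. x \<in> assortments n \<and> y \<in> assortments m}"
  by (rule finite_image_set2) (auto simp: finite_assortments)

lemma assortment_value:
  assumes "x \<in> assortments k" "i \<le> k"
  shows "x i = 0 \<or> x i = 1"
  using assms by (auto simp: assortments_def PiE_def Pi_def)

lemma revenue_nonneg:
  assumes I: "is_instance n m p q u" and x: "x \<in> assortments n" and y: "y \<in> assortments m"
  shows "revenue n m p q u x y \<ge> 0"
proof -
  have *: "u i j * x i * y j \<ge> 0" "p i + q j \<ge> 0" if "i \<in> {0..n}" "j \<in> {0..m}" for i j
  proof -
    have "x i \<ge> 0" "y j \<ge> 0"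
      using assortment_value[OF x, of i] assortment_value[OF y, of j] that by auto
    then show "u i j * x i * y j \<ge> 0"
      using I that by (simp add: is_instance_def)
    have "p i \<ge> 0" "q j \<ge> 0"
      using I that by (cases "i = 0"; cases "j = 0"; simp add: is_instance_def)+
    then show "p i + q j \<ge> 0" by simp
  qed
  show ?thesis
    unfolding revenue_def by (intro divide_nonneg_nonneg sum_nonneg mult_nonneg_nonneg *)
qed

text \<open>Supplies the lower bound 0 on the ratios, without which the real \<open>Inf\<close> in
  \<open>Gap\<close> need not lie below them.\<close>

lemma opt_revenue_nonneg:
  assumes "is_instance n m p q u"
  shows "opt_revenue n m p q u \<ge> 0"
proof -
  define e where "e k = restrict (\<lambda>i. if i = 0 then 1 else 0 :: real) {0..k}" for k :: nat
  have e: "e k \<in> assortments k" for k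
    unfolding e_def by (rule empty_assortment)
  have "0 \<le> revenue n m p q u (e n) (e m)"
    using assms e e by (rule revenue_nonneg)
  also have "\<dots> \<le> opt_revenue n m p q u"
    unfolding opt_revenue_def using e by (intro Max_ge finite_revenues) blast
  finally show ?thesis .
qed

lemma opt_revenue_le:
  assumes "\<And>x y. x \<in> assortments n \<Longrightarrow> y \<in> assortments m \<Longrightarrow> revenue n m p q u x y \<le> c"
  shows "opt_revenue n m p q u \<le> c"
  unfolding opt_revenue_def
proof (rule Max.boundedI)
  show "{revenue n m p q u x y | x y. x \<in> assortments n \<and> y \<in> assortments m} \<noteq> {}"
    using empty_assortment by blast
qed (use assms finite_revenues in auto)

lemma Gap_le:
  assumes "is_instance n m p q u" "lp_value n m p q u > 0"
  shows "Gap \<le> opt_revenue n m p q u / lp_value n m p q u"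
  unfolding Gap_def
proof (rule cInf_lower)
  show "bdd_below {opt_revenue n m p q u / lp_value n m p q u | n m p q u.
          is_instance n m p q u \<and> lp_value n m p q u > 0}"
    by (rule bdd_belowI[where m = 0]) (auto intro!: divide_nonneg_pos opt_revenue_nonneg)
qed (use assms in blast)

lemma lp_feasible_bounds:
  assumes I: "is_instance n m p q u" and F: "lp_feasible n m u x y z w"
    and ij: "i \<in> {1..n}" "j \<in> {1..m}"
  shows "x i \<le> 1" "y j \<le> 1" "z i j \<le> 1"
proof -
  have "(\<Sum>i\<in>{1..n}. \<Sum>j\<in>{1..m}. u i j * z i j) \<ge> 0"
    "(\<Sum>i\<in>{1..n}. u i 0 * x i) \<ge> 0" "(\<Sum>j\<in>{1..m}. u 0 j * y j) \<ge> 0"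
    using I F unfolding is_instance_def lp_feasible_def
    by (auto intro!: sum_nonneg mult_nonneg_nonneg)
  then have "w \<le> 1"
    using F unfolding lp_feasible_def by linarith
  \<comment> \<open>Combining \<open>z i j \<ge> x i + y j - w\<close> with
    \<open>z i j \<le> y j\<close> gives \<open>x i \<le> w\<close>; with
    \<open>z i j \<le> x i\<close> it gives \<open>y j \<le> w\<close>.\<close>
  moreover have "z i j \<le> x i" "z i j \<le> y j" "z i j \<ge> x i + y j - w"
    using F ij unfolding lp_feasible_def by blast+
  ultimately show "x i \<le> 1" "y j \<le> 1" "z i j \<le> 1"
    by linarith+
qed

lemma lp_objective_le_lp_value:
  assumes I: "is_instance n m p q u" and F: "lp_feasible n m u x y z w"
  shows "lp_objective n m p q u x y z \<le> lp_value n m p q u"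
  unfolding lp_value_def
proof (rule cSup_upper)
  let ?B = "(\<Sum>i\<in>{1..n}. \<Sum>j\<in>{1..m}. u i j * (p i + q j))
       + (\<Sum>i\<in>{1..n}. u i 0 * p i) + (\<Sum>j\<in>{1..m}. u 0 j * q j)"
  show "bdd_above {lp_objective n m p q u x y z | x y z w. lp_feasible n m u x y z w}"
  proof (rule bdd_aboveI[where M = ?B], clarify)
    fix x y z w
    assume F: "lp_feasible n m u x y z w"
    \<comment> \<open>Bounding \<open>x i\<close> alone still takes some \<open>j\<close> in range,
      and \<open>y j\<close> some \<open>i\<close>; the index 1 serves.\<close>
    have "1 \<in> {1..n}" "1 \<in> {1..m}"
      using I by (auto simp: is_instance_def)
    then show "lp_objective n m p q u x y z \<le> ?B"
      unfolding lp_objective_def using I lp_feasible_bounds[OF I F]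
      by (intro add_mono sum_mono mult_left_le) (auto simp: is_instance_def)
  qed
qed (use F in blast)

definition gap_price :: "real \<Rightarrow> nat \<Rightarrow> real" where
  "gap_price N i = (if i = 1 then N else if i = 2 then 1 else 0)"

text \<open>The weight \<open>1 / N\<close> cancels the price \<open>N\<close>. Pairs with exactly
  one index 0 get weight 0, so the single-product sums of the LP vanish.\<close>

definition gap_weight :: "real \<Rightarrow> nat \<Rightarrow> nat \<Rightarrow> real" where
  "gap_weight N i j =
     (if (i, j) \<in> {(0, 0), (2, 2), (3, 3)} then 1
      else if (i, j) \<in> {(1, 3), (3, 1)} then 1 / N
      else if (i, j) \<in> {(2, 3), (3, 2)} then N
      else 0)"

lemma is_instance_gap:
  "N > 0 \<Longrightarrow> is_instance 3 3 (gap_price N) (gap_price N) (gap_weight N)"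
  by (auto simp: is_instance_def gap_price_def gap_weight_def)

lemma sum_upto_3:
  fixes f :: "nat \<Rightarrow> real"
  shows "(\<Sum>i\<in>{0..3}. f i) = f 0 + f 1 + f 2 + f 3" "(\<Sum>i\<in>{1..3}. f i) = f 1 + f 2 + f 3"
  by (simp_all add: numeral_eq_Suc)

text \<open>The slack \<open>1 / N\<close> absorbs cases such as offering everything, with revenue
  \<open>(2 * N + 4) / (2 * N + 3 + 2 / N)\<close>, which exceeds 1 for \<open>N > 2\<close>. All 64
  choices are checked.\<close>

lemma revenue_gap_le:
  assumes N: "N \<ge> 1" and x: "x \<in> assortments 3" and y: "y \<in> assortments 3"
  shows "revenue 3 3 (gap_price N) (gap_price N) (gap_weight N) x y \<le> 1 + 1 / N"
proof -
  have 0: "x 0 = 1" "y 0 = 1"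
    using x y by (auto simp: assortments_def)
  have "x 1 = 0 \<or> x 1 = 1" "x 2 = 0 \<or> x 2 = 1" "x 3 = 0 \<or> x 3 = 1"
    "y 1 = 0 \<or> y 1 = 1" "y 2 = 0 \<or> y 2 = 1" "y 3 = 0 \<or> y 3 = 1"
    using assortment_value[OF x] assortment_value[OF y] by simp_all
  then show ?thesis
    using N unfolding revenue_def sum_upto_3 gap_price_def gap_weight_def
    by (elim disjE) (simp_all add: 0 field_simps add_pos_pos)
qed

lemma lp_value_gap_ge:
  assumes N: "N \<ge> 1"
  shows "lp_value 3 3 (gap_price N) (gap_price N) (gap_weight N) \<ge> 4 * N / (3 * N + 2)"
proof -
  define w where "w = 2 * N / (3 * N + 2)"
  define x where "x i = (if i = 1 then w else w / 2)" for i :: nat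
  \<comment> \<open>Each entry is the least allowed, \<open>max 0 (x i + x j - w)\<close>, except
    \<open>z 2 2\<close>, which is the largest allowed.\<close>
  define z where "z i j = (if (i, j) = (1, 1) then w
    else if (i, j) \<in> {(2, 3), (3, 2), (3, 3)} then 0 else w / 2)" for i j :: nat
  have w: "w \<ge> 0"
    using N by (simp add: w_def)
  have "w * (3 * N + 2) = 2 * N"
    using N by (simp add: w_def)
  \<comment> \<open>The normalization: \<open>z 1 3\<close> and \<open>z 3 1\<close> together
    contribute \<open>w / N\<close>, and \<open>z 2 2\<close> contributes
    \<open>w / 2\<close>.\<close>
  then have "w + w / N + w / 2 = 1"
    using N by (simp add: field_simps)
  then have "lp_feasible 3 3 (gap_weight N) x x z w"
    using w unfolding lp_feasible_def sum_upto_3 by (auto simp: x_def z_def gap_weight_def)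
  then have "lp_objective 3 3 (gap_price N) (gap_price N) (gap_weight N) x x z
      \<le> lp_value 3 3 (gap_price N) (gap_price N) (gap_weight N)"
    using N by (intro lp_objective_le_lp_value is_instance_gap) auto
  \<comment> \<open>The pair \<open>(2, 2)\<close> earns \<open>w\<close>; \<open>(1, 3)\<close> and
    \<open>(3, 1)\<close> earn \<open>w / 2\<close> each.\<close>
  moreover have "lp_objective 3 3 (gap_price N) (gap_price N) (gap_weight N) x x z = 2 * w"
    using N unfolding lp_objective_def sum_upto_3
    by (simp add: x_def z_def gap_weight_def gap_price_def)
  ultimately show ?thesis
    by (simp add: w_def)
qed

lemma Gap_le_ratio:
  assumes N: "N \<ge> 1"
  shows "Gap \<le> (1 + 1 / N) * (3 / 4 + 1 / 2 * (1 / N))"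
proof -
  let ?r = "opt_revenue 3 3 (gap_price N) (gap_price N) (gap_weight N)"
  let ?l = "lp_value 3 3 (gap_price N) (gap_price N) (gap_weight N)"
  have I: "is_instance 3 3 (gap_price N) (gap_price N) (gap_weight N)"
    using N by (intro is_instance_gap) auto
  have pos: "4 * N / (3 * N + 2) > 0"
    using N by simp
  then have "Gap \<le> ?r / ?l"
    using lp_value_gap_ge[OF N] by (intro Gap_le I) linarith
  also have "\<dots> \<le> (1 + 1 / N) / (4 * N / (3 * N + 2))"
    using N pos lp_value_gap_ge[OF N] opt_revenue_nonneg[OF I]
    by (intro frac_le opt_revenue_le revenue_gap_le) auto
  also have "\<dots> = (1 + 1 / N) * (3 / 4 + 1 / 2 * (1 / N))"
    using N by (simp add: field_simps)
  finally show ?thesis .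
qed

theorem theorem3:
  shows "Gap \<le> 0.75"
proof (rule tendsto_lowerbound)
  have "(\<lambda>n. (1 + 1 / real n) * (3 / 4 + 1 / 2 * (1 / real n)))
          \<longlonglongrightarrow> (1 + 0) * (3 / 4 + 1 / 2 * 0)"
    by (intro tendsto_intros lim_1_over_n)
  then show "(\<lambda>n. (1 + 1 / real n) * (3 / 4 + 1 / 2 * (1 / real n))) \<longlonglongrightarrow> 0.75"
    by simp
  \<comment> \<open>The bound is claimed only for \<open>n \<ge> 1\<close>, as the instance divides
    by \<open>n\<close>.\<close>
  show "\<forall>\<^sub>F n in sequentially. Gap \<le> (1 + 1 / real n) * (3 / 4 + 1 / 2 * (1 / real n))"
    using eventually_ge_at_top[of 1] by eventually_elim (rule Gap_le_ratio, simp)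
qed simp

end
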